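(* Let $I\subseteq\mathbb{R}$ and $f_1,\dots,f_n\colon I\to\mathbb{R}$ with $$\sum_{i=1}^n f_i(t)=0,\quad f_1(t)\le f_2(t)\le\dots\le f_n(t)\quad\text{and}\quad f_1'(t)\le f_2'(t)\le\dots\le f_n'(t)\qquad\text{for all } t\in I,$$ and assume $g_h,h\colon I\to\mathbb{R}$ with $h$ positive and monotone increasing and $$g_h(t)=\sum_{i=1}^n e^{h(t)f_i(t)}\qquad\text{for all } t\in I .$$ Then $g_h'(t)\ge 0$ for all $t\in I$, which implies that $g_h$ is monotone increasing.
   Context: A prime denotes the derivative with respect to $t$. "Monotone increasing" is meant in the weak (non-strict) sense.
   Formalization: Monotonicity of g_h is claimed only when I is an interval (false otherwise: locally constant f_i on [0,1]∪[2,3]); each point of I is a limit point of I, derivatives are relative to I; g_h' is shown to exist where h is differentiable and to be ≥ 0 wherever it exists. *)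

theory Defs
  imports "HOL-Analysis.Analysis"
begin

end

(*
  Write \<open>S c t\<close> for the sum of the \<open>exp (c * f i t)\<close>. Both partial derivatives of \<open>S\<close> at \<open>c \<ge> 0\<close> are
  sums of products of two increasing sequences, one of which has total zero, so they are nonnegative
  by Chebyshev's sum inequality. Since \<open>h\<close> is increasing,
  the difference quotients of \<open>g\<^sub>h\<close> at \<open>t\<close> dominate those of \<open>S (h t)\<close>.
*)

theory Submission
  imports Defs
begin

text \<open>Chebyshev's sum inequality bounds \<open>n\<close> times this sum below by the product
  of the two totals, which is zero. The library version used takes oppositely ordered sequences
  indexed from 0, hence the negated \<open>b\<close> and the index shift.\<close>

lemma sum_mult_nonneg_if_mono_sum_zero:
  fixes a b :: "nat \<Rightarrow> real"
  assumes "\<And>i j. 1 \<le> i \<Longrightarrow> i \<le> j \<Longrightarrow> j \<le> n \<Longrightarrow> a i \<le> a j"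
    and "\<And>i j. 1 \<le> i \<Longrightarrow> i \<le> j \<Longrightarrow> j \<le> n \<Longrightarrow> b i \<le> b j"
    and "(\<Sum>i=1..n. a i) = 0"
  shows "0 \<le> (\<Sum>i=1..n. a i * b i)"
proof (cases "n = 0")
  case False
  have shift: "(\<Sum>i=1..n. u i) = (\<Sum>i=0..<n. u (Suc i))" for u :: "nat \<Rightarrow> real"
    using sum.shift_bounds_Suc_ivl[of u 0 n] by (simp add: atLeastLessThanSuc_atLeastAtMost)
  have "of_nat n * (\<Sum>i=0..<n. a (Suc i) * - b (Suc i))
      \<le> (\<Sum>i=0..<n. a (Suc i)) * (\<Sum>i=0..<n. - b (Suc i))"
    by (rule Chebyshev_sum_upper) (use assms in auto)
  then have "0 \<le> real n * (\<Sum>i=1..n. a i * b i)"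
    using assms(3) by (simp add: shift sum_negf del: One_nat_def)
  with False show ?thesis
    by (simp add: zero_le_mult_iff)
qed simp

text \<open>The slope in \<open>c\<close> is the sum of the \<open>x i * exp (c * x i)\<close>. For
  \<open>c \<ge> 0\<close> the factors \<open>exp (c * x i)\<close> increase with \<open>i\<close>,
  so this slope is nonnegative; by convexity the sum at \<open>d\<close> lies above the tangent at
  \<open>c\<close>.\<close>

lemma sum_exp_mono_if_sum_zero:
  fixes x :: "nat \<Rightarrow> real"
  assumes "\<And>i j. 1 \<le> i \<Longrightarrow> i \<le> j \<Longrightarrow> j \<le> n \<Longrightarrow> x i \<le> x j"
    and "(\<Sum>i=1..n. x i) = 0" and "0 \<le> c" and "c \<le> d"
  shows "(\<Sum>i=1..n. exp (c * x i)) \<le> (\<Sum>i=1..n. exp (d * x i))"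
proof -
  have "0 \<le> (\<Sum>i=1..n. x i * exp (c * x i))"
    by (rule sum_mult_nonneg_if_mono_sum_zero) (use assms in \<open>auto intro: mult_left_mono\<close>)
  then have "(\<Sum>i=1..n. exp (c * x i))
      \<le> (\<Sum>i=1..n. exp (c * x i)) + (d - c) * (\<Sum>i=1..n. x i * exp (c * x i))"
    using assms(4) by simp
  also have "\<dots> = (\<Sum>i=1..n. exp (c * x i) * (1 + (d - c) * x i))"
    by (simp add: sum_distrib_left sum.distrib[symmetric] algebra_simps)
  \<comment> \<open>The tangent bound \<open>1 + y \<le> exp y\<close> holds for \<open>y\<close> of
    either sign, as needed here because the \<open>x i\<close> sum to zero.\<close>
  also have "\<dots> \<le> (\<Sum>i=1..n. exp (c * x i) * exp ((d - c) * x i))"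
    by (intro sum_mono mult_left_mono exp_ge_add_one_self) simp
  also have "\<dots> = (\<Sum>i=1..n. exp (d * x i))"
    by (simp flip: exp_add add: algebra_simps)
  finally show ?thesis .
qed

text \<open>The quotients of \<open>u\<close> at \<open>t\<close> lie below those of
  \<open>v\<close> on both sides, since dividing by \<open>s - t < 0\<close> reverses the inequality
  on the left. The limit point condition makes the filter nontrivial, so the order passes to the
  limits.\<close>

lemma has_real_derivative_le_if_touching:
  fixes u v :: "real \<Rightarrow> real"
  assumes "t islimpt I"
    and "(u has_real_derivative A) (at t within I)"
    and "(v has_real_derivative B) (at t within I)"
    and "u t = v t"
    and "\<And>s. s \<in> I \<Longrightarrow> t < s \<Longrightarrow> u s \<le> v s"
    and "\<And>s. s \<in> I \<Longrightarrow> s < t \<Longrightarrow> v s \<le> u s"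
  shows "A \<le> B"
proof (rule tendsto_le)
  show "at t within I \<noteq> bot"
    using assms(1) by (simp add: trivial_limit_within)
  show "((\<lambda>s. (v s - v t) / (s - t)) \<longlongrightarrow> B) (at t within I)"
    using assms(3) by (simp add: has_field_derivative_iff)
  show "((\<lambda>s. (u s - u t) / (s - t)) \<longlongrightarrow> A) (at t within I)"
    using assms(2) by (simp add: has_field_derivative_iff)
  have "(u s - u t) / (s - t) \<le> (v s - v t) / (s - t)" if "s \<in> I" "s \<noteq> t" for s
  proof (cases "t < s")
    case True
    then show ?thesis using assms(4,5) that by (simp add: divide_right_mono)
  next
    case False
    then show ?thesis using assms(4,6) that by (simp add: divide_right_mono_neg)
  qed
  then show "\<forall>\<^sub>F s in at t within I. (u s - u t) / (s - t) \<le> (v s - v t) / (s - t)"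
    by (auto simp: eventually_at_filter)
qed

theorem theorem4p5:
  fixes I :: "real set" and n :: nat
    and f f' :: "nat \<Rightarrow> real \<Rightarrow> real"
    and h g\<^sub>h :: "real \<Rightarrow> real"
  assumes "\<And>t. t \<in> I \<Longrightarrow> t islimpt I"
    and "\<And>i t. i \<in> {1..n} \<Longrightarrow> t \<in> I \<Longrightarrow>
           (f i has_real_derivative f' i t) (at t within I)"
    and "\<And>t. t \<in> I \<Longrightarrow> (\<Sum>i=1..n. f i t) = 0"
    and "\<And>i j t. 1 \<le> i \<Longrightarrow> i \<le> j \<Longrightarrow> j \<le> n \<Longrightarrow> t \<in> I \<Longrightarrow> f i t \<le> f j t"
    and "\<And>i j t. 1 \<le> i \<Longrightarrow> i \<le> j \<Longrightarrow> j \<le> n \<Longrightarrow> t \<in> I \<Longrightarrow> f' i t \<le> f' j t"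
    and "\<And>t. t \<in> I \<Longrightarrow> h t > 0"
    and "mono_on I h"
    and "\<And>t. t \<in> I \<Longrightarrow> g\<^sub>h t = (\<Sum>i=1..n. exp (h t * f i t))"
  shows "(\<forall>t\<in>I. h differentiable (at t within I) \<longrightarrow> g\<^sub>h differentiable (at t within I)) \<and>
         (\<forall>t\<in>I. \<forall>D. (g\<^sub>h has_real_derivative D) (at t within I) \<longrightarrow> D \<ge> 0) \<and>
         (is_interval I \<longrightarrow> mono_on I g\<^sub>h)"
proof (intro conjI ballI allI impI)
  define S where "S c t = (\<Sum>i=1..n. exp (c * f i t))" for c t
  define S' where "S' c t = (\<Sum>i=1..n. f' i t * (c * exp (c * f i t)))" for c t
  have gS: "g\<^sub>h t = S (h t) t" if "t \<in> I" for t
    using assms(8) that by (simp add: S_def)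
  have deriv_S: "(S c has_real_derivative S' c t) (at t within I)" if "t \<in> I" for c t
    unfolding S_def S'_def
    by (auto intro!: derivative_eq_intros sum.cong assms(2) that)
  \<comment> \<open>The sum of the \<open>f i\<close> agrees with the zero function on
    \<open>I\<close>, so each touches the other from both sides and the comparison of derivatives
    applies in both directions.\<close>
  have sum_f': "(\<Sum>i=1..n. f' i t) = 0" if "t \<in> I" for t
  proof -
    have sum_deriv: "((\<lambda>s. \<Sum>i=1..n. f i s) has_real_derivative (\<Sum>i=1..n. f' i t)) (at t within I)"
      by (intro DERIV_sum assms(2) that)
    have zero_deriv: "((\<lambda>s. 0) has_real_derivative 0) (at t within I)"
      by simp
    show ?thesis
    proof (rule order_antisym)
      show "(\<Sum>i=1..n. f' i t) \<le> 0"
        by (rule has_real_derivative_le_if_touching[OF assms(1)[OF that] sum_deriv zero_deriv])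
          (simp_all only: assms(3) that order_refl)
      show "0 \<le> (\<Sum>i=1..n. f' i t)"
        by (rule has_real_derivative_le_if_touching[OF assms(1)[OF that] zero_deriv sum_deriv])
          (simp_all only: assms(3) that order_refl)
    qed
  qed
  \<comment> \<open>Here the \<open>f' i t\<close> form the sequence with total zero, and
    \<open>c * exp (c * f i t)\<close> the other increasing one.\<close>
  have S'_nonneg: "0 \<le> S' c t" if "t \<in> I" "0 \<le> c" for c t
    unfolding S'_def
    by (rule sum_mult_nonneg_if_mono_sum_zero)
      (use assms(4,5) sum_f' that in \<open>auto intro!: mult_left_mono\<close>)
  have S_mono: "S c t \<le> S d t" if "t \<in> I" "0 \<le> c" "c \<le> d" for c d t
    unfolding S_def by (rule sum_exp_mono_if_sum_zero) (use assms(3,4) that in auto)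
  have h_nonneg: "0 \<le> h t" if "t \<in> I" for t
    using assms(6)[OF that] by simp
  have h_mono: "h s \<le> h t" if "s \<in> I" "t \<in> I" "s \<le> t" for s t
    using assms(7) that by (auto dest: mono_onD)

  show "g\<^sub>h differentiable (at t within I)"
    if t: "t \<in> I" and h: "h differentiable (at t within I)" for t
  proof -
    obtain h' where "(h has_real_derivative h') (at t within I)"
      using h by (auto simp: real_differentiable_def)
    then have "((\<lambda>s. \<Sum>i=1..n. exp (h s * f i s)) has_real_derivative
        (\<Sum>i=1..n. exp (h t * f i t) * (h' * f i t + f' i t * h t))) (at t within I)"
      by (intro DERIV_sum DERIV_chain2[OF DERIV_exp] DERIV_mult assms(2) t)
    then have "(\<lambda>s. \<Sum>i=1..n. exp (h s * f i s)) differentiable (at t within I)"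
      by (auto simp: real_differentiable_def)
    then show ?thesis
      by (rule differentiable_transform_within[where d = 1]) (use assms(8) t in auto)
  qed

  show "0 \<le> D" if t: "t \<in> I" and D: "(g\<^sub>h has_real_derivative D) (at t within I)" for t D
  proof -
    \<comment> \<open>Freezing the first argument of \<open>S\<close> at \<open>h t\<close> gives a
      function that meets \<open>g\<^sub>h\<close> at \<open>t\<close>, lies below it to the right
      and above it to the left, because \<open>h\<close> increases and \<open>S\<close> increases in
      its first argument.\<close>
    have "S' (h t) t \<le> D"
    proof (rule has_real_derivative_le_if_touching[OF assms(1)[OF t] deriv_S[OF t] D])
      show "S (h t) s \<le> g\<^sub>h s" if "s \<in> I" "t < s" for s
        using S_mono h_nonneg h_mono gS t that by simp
      show "g\<^sub>h s \<le> S (h t) s" if "s \<in> I" "s < t" for s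
        using S_mono h_nonneg h_mono gS t that by simp
    qed (use gS t in simp)
    with S'_nonneg[OF t h_nonneg[OF t]] show ?thesis by simp
  qed

  show "mono_on I g\<^sub>h" if I: "is_interval I"
  proof (rule mono_onI)
    fix s t assume st: "s \<in> I" "t \<in> I" "s \<le> t"
    have sub: "{s..t} \<subseteq> I"
      using mem_is_interval_1_I[OF I st(1,2)] by auto
    \<comment> \<open>As \<open>g\<^sub>h\<close> may fail to be differentiable, the passage from
      \<open>s\<close> to \<open>t\<close> is split: first time moves with the factor frozen at
      \<open>h s\<close>, where the mean value theorem applies, then the factor rises to
      \<open>h t\<close> at the fixed time \<open>t\<close>.\<close>
    have "\<exists>x\<in>{s..t}. S (h s) t - S (h s) s = S' (h s) x * (t - s)"
    proof (rule mvt_very_simple[OF st(3)])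
      show "(S (h s) has_derivative (*) (S' (h s) x)) (at x within {s..t})" if "s \<le> x" "x \<le> t" for x
        using DERIV_subset[OF deriv_S sub] sub that by (auto simp: has_field_derivative_def)
    qed
    then obtain x where x: "x \<in> {s..t}" "S (h s) t - S (h s) s = S' (h s) x * (t - s)" ..
    moreover have "0 \<le> S' (h s) x * (t - s)"
      using S'_nonneg h_nonneg sub st x(1) by (intro mult_nonneg_nonneg) auto
    ultimately have "S (h s) s \<le> S (h s) t"
      by simp
    also have "\<dots> \<le> S (h t) t"
      using S_mono h_nonneg h_mono st by simp
    finally show "g\<^sub>h s \<le> g\<^sub>h t"
      using gS st by simp
  qed
qed

end
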